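(* (i) For every real $q$ with $0<q<1$, $$\frac{(q^{1/2};q)_\infty^3\,(q^{5/2};q)_\infty}{(q;q)_\infty^4} =\sum_{n=0}^{\infty}q^{2n^2}\frac{(q^{1/2};q)_n^3\,(q^{1/2};q)_{2n+1}^3\,(q^{3/2};q)_{3n}\,(1-q^{4n+\frac32})}{(q;q)_n\,(q;q)_{2n}\,(q;q)_{3n+1}^3\,(1-q^{3/2})}$$ $$\times\Bigg\{q^n+\frac{(1-q^n)(1-q^{3n+1})^3(1-q^{5n+\frac12})}{(1-q^{3n+\frac12})(1-q^{2n+\frac12})^3(1-q^{4n+\frac32})}+q^{3n+1}\frac{(1-q^{n+\frac12})^3(1-q^{3n+\frac32})(1-q^{5n+\frac72})}{(1-q^{3n+2})^3(1-q^{2n+1})(1-q^{4n+\frac32})}\Bigg\}.$$ (ii) The corresponding classical identity (the case $q\to1$) holds: $$\frac{32}{\pi^2}=\sum_{n=0}^{\infty}(3+8n)\frac{(\frac12)_n^3\,(\frac32)_{2n}^3\,(\frac32)_{3n}}{n!\,(2n)!\,((3n+1)!)^3}\Bigg\{1+\frac{16n(1+3n)^3(1+10n)}{(1+4n)^3(1+6n)(3+8n)}+\frac{3(1+2n)^3(7+10n)}{16(2+3n)^3(3+8n)}\Bigg\}.$$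
   Context: $(x;q)_0=1$, $(x;q)_n=\prod_{j=0}^{n-1}(1-q^jx)$, $(x;q)_\infty=\prod_{j\ge0}(1-q^jx)$. Fractional powers of $q$ are the positive real ones. $(x)_0=1$ and $(x)_n=x(x+1)\cdots(x+n-1)$ is the ordinary shifted factorial. *)

theory Defs
  imports "HOL-Analysis.Analysis"
begin

definition qpoch :: "real \<Rightarrow> real \<Rightarrow> nat \<Rightarrow> real" where
  "qpoch x q n = (\<Prod>j<n. 1 - q ^ j * x)"

(* For \<bar>q\<bar> < 1 the product converges, possibly with value 0, so prodinf is meaningful there. *)
definition qpoch_inf :: "real \<Rightarrow> real \<Rightarrow> real" where
  "qpoch_inf x q = (\<Prod>j. 1 - q ^ j * x)"

end

(* The summand of the nonterminating q-Dougall sum (6-phi-5) with b = c = d = q^(1/2), a = q^(m+3/2),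
   suitably normalised, is a function H(m,k) with a Wilf-Zeilberger partner G:
   H(m+1,k) - H(m,k) = G(m,k+1) - G(m,k) and G(m,0) = 0. Summing this closed form along the staircase
   (2n-1,n) -> (2n,n) -> (2n,n+1) -> (2n+1,n+1) gives exactly the three terms in the braces, so the partial
   sums of the accelerated series equal the truncated rows sum_{k <= N} H(2N+1,k). Of such a row only
   H(2N+1,0) survives in the limit, and it tends to the infinite product. For q -> 1 the limiting
   pair works in the same way and H(m,0) is evaluated by Wallis' product. *)

theory Submission
  imports Defs
begin

section \<open>Summing a Wilf-Zeilberger pair along a staircase\<close>

lemma wz_staircase_sums:
  fixes H G :: "nat \<Rightarrow> nat \<Rightarrow> real"
  assumes wz: "\<And>m k. H (Suc m) k - H m k = G m (Suc k) - G m k"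
    and G0: "\<And>m. G m 0 = 0"
    and t0: "t 0 = H 0 0 + G 0 1"
    and tSuc: "\<And>n. t (Suc n) = G (2*n+1) (n+1) + H (2*n+2) (n+1) + G (2*n+2) (n+2)"
    and lim: "(\<lambda>m. H m 0) \<longlonglongrightarrow> L"
    and bnd: "\<And>m k. 1 \<le> k \<Longrightarrow> k \<le> m \<Longrightarrow> \<bar>H m k\<bar> \<le> e m"
    and e: "(\<lambda>m. real m * e m) \<longlonglongrightarrow> 0"
  shows "t sums L"
proof -
  \<comment> \<open>Summing \<open>wz\<close> over k < N telescopes, and \<open>G0\<close> removes
    the lower boundary term: descending one row costs exactly \<open>G m N\<close>.\<close>
  have row: "(\<Sum>k<N. H (Suc m) k) = (\<Sum>k<N. H m k) + G m N" for m N
    by (induction N) (use wz[of m] G0 in \<open>auto simp: algebra_simps\<close>)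
  \<comment> \<open>The step to N + 1 first descends from row 2N+1 to 2N+2 with N+1 columns, then
    appends column N+1, then descends to row 2N+3 with N+2 columns. The three increments are the
    three terms of \<open>tSuc\<close>.\<close>
  have part: "(\<Sum>n<Suc N. t n) = (\<Sum>k<Suc N. H (2*N+1) k)" for N
  proof (induction N)
    case 0
    show ?case using wz[of 0 0] G0 t0 by simp
  next
    case (Suc N)
    have "(\<Sum>k<Suc (Suc N). H (2 * Suc N + 1) k)
        = (\<Sum>k<Suc (Suc N). H (Suc (2*N+1)) k) + G (2*N+2) (Suc (Suc N))"
      using row[of "2*N+2" "Suc (Suc N)"] by simp
    also have "(\<Sum>k<Suc (Suc N). H (Suc (2*N+1)) k)
        = (\<Sum>k<Suc N. H (2*N+1) k) + G (2*N+1) (Suc N) + H (2*N+2) (Suc N)"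
      by (simp only: row[of "2*N+1" "Suc N"] sum.lessThan_Suc[of _ "Suc N"]) simp
    finally show ?case using Suc.IH tSuc[of N] by simp
  qed
  \<comment> \<open>Only columns 1 to N of row 2N+1 remain here. They lie in the range k <= m where
    \<open>bnd\<close> applies, and there are at most 2N+1 of them.\<close>
  have "(\<lambda>N. (\<Sum>k<Suc N. H (2*N+1) k) - H (2*N+1) 0) \<longlonglongrightarrow> 0"
  proof (rule Lim_null_comparison)
    show "(\<lambda>N. real (2*N+1) * e (2*N+1)) \<longlonglongrightarrow> 0"
      using LIMSEQ_subseq_LIMSEQ[OF e, of "\<lambda>N. 2*N+1"] by (simp add: strict_mono_def o_def)
    show "\<forall>\<^sub>F N in sequentially.
        norm ((\<Sum>k<Suc N. H (2*N+1) k) - H (2*N+1) 0) \<le> real (2*N+1) * e (2*N+1)"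
    proof (rule always_eventually, rule allI)
      fix N :: nat
      \<comment> \<open>\<open>e\<close> dominates an absolute value, so it is nonnegative here;
        this permits replacing N copies of it by 2N+1.\<close>
      have e0: "0 \<le> e (2*N+1)" using bnd[of 1 "2*N+1"] by simp
      have "norm ((\<Sum>k<Suc N. H (2*N+1) k) - H (2*N+1) 0) = \<bar>\<Sum>k<N. H (2*N+1) (Suc k)\<bar>"
        by (simp add: sum.lessThan_Suc_shift del: sum.lessThan_Suc)
      also have "\<dots> \<le> (\<Sum>k<N. \<bar>H (2*N+1) (Suc k)\<bar>)" by (rule sum_abs)
      also have "\<dots> \<le> (\<Sum>k<N. e (2*N+1))" by (intro sum_mono bnd) auto
      also have "\<dots> \<le> real (2*N+1) * e (2*N+1)"
        using e0 by (simp add: mult_right_mono)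
      finally show "norm ((\<Sum>k<Suc N. H (2*N+1) k) - H (2*N+1) 0) \<le> real (2*N+1) * e (2*N+1)" .
    qed
  qed
  moreover have "(\<lambda>N. H (2*N+1) 0) \<longlonglongrightarrow> L"
    using LIMSEQ_subseq_LIMSEQ[OF lim, of "\<lambda>N. 2*N+1"] by (simp add: strict_mono_def o_def)
  ultimately have "(\<lambda>N. (\<Sum>k<Suc N. H (2*N+1) k)) \<longlonglongrightarrow> 0 + L"
    using tendsto_add by fastforce
  then have "(\<lambda>N. \<Sum>n<Suc N. t n) \<longlonglongrightarrow> L"
    by (simp only: part) simp
  then show ?thesis
    unfolding sums_def by (rule LIMSEQ_imp_Suc)
qed

section \<open>The q-shifted factorial and its infinite product\<close>

lemma qpoch_Suc: "qpoch x q (Suc n) = qpoch x q n * (1 - q ^ n * x)"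
  by (simp add: qpoch_def)

lemma qpoch_Suc_shift: "qpoch x q (Suc n) = (1 - x) * qpoch (q * x) q n"
  by (simp add: qpoch_def prod.lessThan_Suc_shift mult.assoc mult.left_commute
      del: prod.lessThan_Suc)

lemma qpoch_factor_bounds:
  fixes q x :: real
  assumes "0 < q" "q < 1" "0 < x" "x < 1"
  shows "0 < 1 - q ^ j * x" "1 - q ^ j * x \<le> 1"
proof -
  have "q ^ j \<le> 1" using assms by (simp add: power_le_one)
  then have "q ^ j * x \<le> x" using assms by (simp add: mult_left_le_one_le)
  then show "0 < 1 - q ^ j * x" using assms by linarith
  show "1 - q ^ j * x \<le> 1" using assms by simp
qed

lemma qpoch_pos:
  assumes "0 < q" "q < 1" "0 < x" "x < 1" shows "0 < qpoch x q n"
  unfolding qpoch_def using qpoch_factor_bounds[OF assms] by (intro prod_pos) auto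

lemma qpoch_le_1:
  assumes "0 < q" "q < 1" "0 < x" "x < 1" shows "qpoch x q n \<le> 1"
  unfolding qpoch_def using qpoch_factor_bounds[OF assms] by (intro prod_le_1) (simp add: less_imp_le)

lemma qpoch_abs_convergent:
  fixes q x :: real assumes "0 < q" "q < 1" shows "abs_convergent_prod (\<lambda>j. 1 - q ^ j * x)"
proof -
  have "summable (\<lambda>j. q ^ j * \<bar>x\<bar>)" using assms by (intro summable_mult2 summable_geometric) simp
  then show ?thesis using assms
    by (simp add: abs_convergent_prod_conv_summable abs_mult)
qed

lemma qpoch_LIMSEQ:
  assumes "0 < q" "q < 1" shows "qpoch x q \<longlonglongrightarrow> qpoch_inf x q"
proof -
  have "(\<lambda>n. \<Prod>j\<le>n. 1 - q ^ j * x) \<longlonglongrightarrow> qpoch_inf x q"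
    unfolding qpoch_inf_def
    by (intro convergent_prod_LIMSEQ abs_convergent_prod_imp_convergent_prod qpoch_abs_convergent assms)
  then have "(\<lambda>n. qpoch x q (Suc n)) \<longlonglongrightarrow> qpoch_inf x q"
    by (simp add: qpoch_def lessThan_Suc_atMost)
  then show ?thesis by (rule LIMSEQ_imp_Suc)
qed

text \<open>All factors lie in (0,1], so the finite products decrease to their limit. Positivity of
  the terms alone gives only a nonnegative limit; the value 0 is excluded because a convergent
  product of nonzero factors is nonzero.\<close>

lemma qpoch_inf_lower_bound:
  assumes "0 < q" "q < 1" "0 < x" "x < 1"
  shows "0 < qpoch_inf x q" "qpoch_inf x q \<le> qpoch x q n"
proof -
  have "decseq (qpoch x q)"
  proof (rule decseq_SucI)
    fix n show "qpoch x q (Suc n) \<le> qpoch x q n"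
      using qpoch_pos[OF assms, of n] qpoch_factor_bounds(2)[OF assms, of n]
      by (simp add: qpoch_Suc mult_left_le)
  qed
  from decseq_ge[OF this qpoch_LIMSEQ[OF assms(1,2)]] show le: "qpoch_inf x q \<le> qpoch x q n" .
  have "qpoch_inf x q \<noteq> 0"
    unfolding qpoch_inf_def
  proof (rule prodinf_nonzero)
    show "convergent_prod (\<lambda>j. 1 - q ^ j * x)"
      by (intro abs_convergent_prod_imp_convergent_prod qpoch_abs_convergent assms)
    show "1 - q ^ j * x \<noteq> 0" for j
      using qpoch_factor_bounds(1)[OF assms, of j] by simp
  qed
  moreover have "0 \<le> qpoch_inf x q"
    using qpoch_pos[OF assms] by (intro LIMSEQ_le_const[OF qpoch_LIMSEQ[OF assms(1,2)]]) (auto intro: less_imp_le)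
  ultimately show "0 < qpoch_inf x q" by simp
qed

section \<open>The q-Wilf-Zeilberger pair, with s in the role of q^(1/2)\<close>

definition qH :: "real \<Rightarrow> real \<Rightarrow> nat \<Rightarrow> nat \<Rightarrow> real" where
  "qH s q m k = qpoch s q k ^ 3 * qpoch s q (m+1) ^ 3 * qpoch (s^3) q (m+k) * q ^ ((m+1)*k)
     * (1 - q ^ (2*k+m) * s^3)
     / (qpoch q q k * qpoch q q m * qpoch q q (m+k+1) ^ 3 * (1 - s^3))"

text \<open>This is \<open>qH s q m k\<close> times the rational certificate (1 - q^k)(1 - q^(2m+k)
  s^5) / ((1 - q^(m+1))(1 - q^(2k+m) s^3)). The factor 1 - q^k makes it vanish in column 0.\<close>

definition qG :: "real \<Rightarrow> real \<Rightarrow> nat \<Rightarrow> nat \<Rightarrow> real" where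
  "qG s q m k = qpoch s q k ^ 3 * qpoch s q (m+1) ^ 3 * qpoch (s^3) q (m+k) * q ^ ((m+1)*k)
     * (1 - q ^ k) * (1 - q ^ (2*m+k) * s^5)
     / (qpoch q q k * qpoch q q (m+1) * qpoch q q (m+k+1) ^ 3 * (1 - s^3))"

text \<open>With p = 1 - x v s and W = (1 - s^2 x v)^3 the claim reads A p - C W = B p - D W. It
  splits into two smaller identities, A - B = r W and C - D = r p, with the same cofactor r = x - v,
  so that (A - B) p and (C - D) W both equal r p W.\<close>

lemma q_wz_polynomial:
  fixes s x v :: real
  shows "(1 - s * v)^3 * (1 - x * v * s) * (1 - x^2 * v * s^3) * x - (1 - x^2 * v * s) * (1 - v) * (1 - s^2 * x * v)^3
    = (1 - x * s)^3 * (1 - x * v * s) * (1 - v^2 * x * s^3) * v - (1 - x) * (1 - v^2 * x * s) * (1 - s^2 * x * v)^3"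
\<comment> \<open>The identity \<open>two\<close> is applied to the multiples of x and v by s, which
  produces a common factor s that has to be cancelled.\<close>
proof (cases "s = 0")
  case True
  then show ?thesis by (simp add: algebra_simps)
next
  case False
  have two: "(1-V)^3 * (1 - X^2 * V) * X - (1-X)^3 * (1 - V^2 * X) * V = (X-V) * (1-X * V)^3" for X V :: real
    by (simp add: algebra_simps eval_nat_numeral)
  have "s * ((1 - s * v)^3 * (1 - x^2 * v * s^3) * x - (1 - x * s)^3 * (1 - v^2 * x * s^3) * v)
      = s * ((x - v) * (1 - s^2 * x * v)^3)"
    using two[of "s * v" "s * x"] by (simp add: power_mult_distrib algebra_simps power2_eq_square power3_eq_cube)
  then have h1: "(1 - s * v)^3 * (1 - x^2 * v * s^3) * x - (1 - x * s)^3 * (1 - v^2 * x * s^3) * v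
      = (x - v) * (1 - s^2 * x * v)^3"
    using False by simp
  have h2: "(1 - x^2 * v * s) * (1 - v) - (1 - x) * (1 - v^2 * x * s) = (x - v) * (1 - x * v * s)"
    by (simp add: algebra_simps power2_eq_square)
  have aux: "A * p - C * W = B * p - D * W"
    if "A - B = r * W" "C - D = r * p" for A B C D W p r :: real
  proof -
    have "(A - B) * p = (C - D) * W" using that by simp
    then show ?thesis by (simp add: algebra_simps)
  qed
  show ?thesis
    using aux[OF h1 h2] by (simp only: mult_ac)
qed

text \<open>Raising an index by one multiplies each shifted factorial by a single factor. Hence the
  four terms share the factor \<open>B\<close>, and only a polynomial identity in q^k, q^m and s
  remains.\<close>

lemma q_wz:
  assumes s: "0 < s" "s < 1" and q: "q = s^2"
  shows "qH s q (Suc m) k - qH s q m k = qG s q m (Suc k) - qG s q m k"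
proof -
  define x y z where "x = q^k" and "y = q^m" and "z = q^(m*k)"
  define a b c d e f where "a = qpoch s q k" and "b = qpoch s q (m+1)"
    and "c = qpoch (s^3) q (m+k)" and "d = qpoch q q k" and "e = qpoch q q m"
    and "f = qpoch q q (m+k+1)"
  define t u v w where "t = 1 - s^3" and "u = 1 - y * q" and "v = 1 - x * q" and "w = 1 - x * y * q^2"
  note defs = x_def y_def z_def a_def b_def c_def d_def e_def f_def t_def u_def v_def w_def
  have q01: "0 < q" "q < 1" using s by (auto simp: q power_less_one_iff)
  have s3: "s^3 < 1" using s by (simp add: power_less_one_iff)
  have nz: "d \<noteq> 0" "e \<noteq> 0" "f \<noteq> 0" "t \<noteq> 0"
    using qpoch_pos[OF q01 q01] s3 by (auto simp: d_def e_def f_def t_def less_imp_neq[symmetric])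
  have nz': "v \<noteq> 0" "u \<noteq> 0" "w \<noteq> 0"
    using qpoch_factor_bounds(1)[OF q01 q01, of k] qpoch_factor_bounds(1)[OF q01 q01, of m]
      qpoch_factor_bounds(1)[OF q01 q01, of "m+k+1"]
    by (auto simp: defs power_add power2_eq_square mult_ac)
  have exps: "q ^ ((m+1)*k) = z * x" "q ^ ((Suc m+1)*k) = z * x * x" "q ^ ((m+1)*Suc k) = z * x * (y * q)"
    by (simp_all add: x_def y_def z_def power_add algebra_simps)
  have exps': "q ^ (2*k+m) = x^2 * y" "q ^ (2*k+Suc m) = x^2 * y * q"
    "q ^ (2*m+k) = y^2 * x" "q ^ (2*m+Suc k) = y^2 * x * q" "q ^ k = x" "q ^ Suc k = x * q"
    by (simp_all add: x_def y_def power_add power_even_eq power_commutes mult.assoc)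
  have qps: "qpoch s q k = a" "qpoch s q (Suc k) = a * (1 - x * s)"
    "qpoch s q (m+1) = b" "qpoch s q (Suc m+1) = b * (1 - y * q * s)"
    "qpoch (s^3) q (m+k) = c" "qpoch (s^3) q (Suc m+k) = c * (1 - x * y * s^3)"
    "qpoch (s^3) q (m+Suc k) = c * (1 - x * y * s^3)"
    "qpoch q q k = d" "qpoch q q (Suc k) = d * v" "qpoch q q m = e" "qpoch q q (Suc m) = e * u"
    "qpoch q q (m+1) = e * u" "qpoch q q (m+k+1) = f" "qpoch q q (Suc m+k+1) = f * w"
    "qpoch q q (m+Suc k+1) = f * w" "1 - s^3 = t"
    by (simp_all add: defs qpoch_Suc power_add power2_eq_square mult_ac)
  define B where "B = a^3 * b^3 * c * (z * x) / (d * (e * u) * (f * w)^3 * t)"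
  have H0: "qH s q m k = B * ((1 - x^2 * y * s^3) * u * w^3)"
    unfolding qH_def exps exps' qps B_def using nz nz' by (simp add: power_mult_distrib)
  have H1: "qH s q (Suc m) k = B * ((1 - y * q * s)^3 * (1 - x * y * s^3) * (1 - x^2 * y * q * s^3) * x)"
    unfolding qH_def exps exps' qps B_def using nz nz' by (simp add: power_mult_distrib)
  have G0: "qG s q m k = B * ((1 - x) * (1 - y^2 * x * s^5) * w^3)"
    unfolding qG_def exps exps' qps B_def using nz nz' by (simp add: power_mult_distrib)
  have G1: "qG s q m (Suc k) = B * ((1 - x * s)^3 * (1 - x * y * s^3) * (1 - y^2 * x * q * s^5) * (y * q))"
    unfolding qG_def exps exps' qps B_def v_def[symmetric] using nz nz' by (simp add: power_mult_distrib mult_ac)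
  \<comment> \<open>This is \<open>q_wz_polynomial\<close> with x = q^k and v = q^(m+1); the
    equation q = s^2 matches the mixed powers of q and s.\<close>
  have "(1 - y * q * s)^3 * (1 - x * y * s^3) * (1 - x^2 * y * q * s^3) * x
         - (1 - x^2 * y * s^3) * u * w^3
      = (1 - x * s)^3 * (1 - x * y * s^3) * (1 - y^2 * x * q * s^5) * (y * q)
         - (1 - x) * (1 - y^2 * x * s^5) * w^3"
  proof -
    have e: "s * (y * q) = y * q * s" "x * (y * q) * s = x * y * s^3" "x^2 * (y * q) * s^3 = x^2 * y * q * s^3"
      "x^2 * (y * q) * s = x^2 * y * s^3" "s^2 * x * (y * q) = x * y * q^2"
      "(y * q)^2 * x * s^3 = y^2 * x * q * s^5" "(y * q)^2 * x * s = y^2 * x * s^5"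
      by (simp_all add: q eval_nat_numeral mult_ac)
    show ?thesis
      using q_wz_polynomial[of s "y * q" x] unfolding e u_def w_def .
  qed
  then show ?thesis
    unfolding H0 H1 G0 G1 by (simp only: right_diff_distrib[symmetric])
qed


text \<open>In the numerator every factor other than the power of q lies in [0,1], and k >= 1 makes
  that power at most q^m. The five factors (q;q) in the denominator are each at least their infinite
  product, which gives a constant independent of m and k.\<close>

lemma qH_bound:
  assumes s: "0 < s" "s < 1" and q: "0 < q" "q < 1" and k: "1 \<le> k"
  shows "\<bar>qH s q m k\<bar> \<le> q ^ m / (qpoch_inf q q ^ 5 * (1 - s^3))"
proof -
  have s3: "0 < s^3" "s^3 < 1" using s by (auto simp: power_less_one_iff)
  note pos = qpoch_pos[OF q s] qpoch_pos[OF q s3] qpoch_pos[OF q q]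
  note le1 = qpoch_le_1[OF q s] qpoch_le_1[OF q s3]
  note fac = qpoch_factor_bounds[OF q s3]
  let ?N = "qpoch s q k ^ 3 * qpoch s q (m+1) ^ 3 * qpoch (s^3) q (m+k) * q ^ ((m+1)*k)
     * (1 - q ^ (2*k+m) * s^3)"
  let ?D = "qpoch q q k * qpoch q q m * qpoch q q (m+k+1) ^ 3 * (1 - s^3)"
  have N0: "0 \<le> ?N"
    using pos fac q by (intro mult_nonneg_nonneg zero_le_power) (auto intro: less_imp_le)
  have "?N \<le> 1 * 1 * 1 * q ^ ((m+1)*k) * 1"
    using pos le1 fac q
    by (intro mult_mono mult_nonneg_nonneg zero_le_power power_le_one) (auto intro: less_imp_le)
  also have "\<dots> \<le> q ^ m"
    using q mult_le_mono2[OF k, of "m+1"] by (simp add: power_decreasing)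
  finally have N: "?N \<le> q ^ m" .
  note c = qpoch_inf_lower_bound[OF q q]
  have "qpoch_inf q q * qpoch_inf q q * qpoch_inf q q ^ 3 * (1 - s^3) \<le> ?D"
    using c s3 pos by (intro mult_mono mult_nonneg_nonneg zero_le_power power_mono) (auto intro: less_imp_le)
  then have D: "qpoch_inf q q ^ 5 * (1 - s^3) \<le> ?D"
    by (simp add: eval_nat_numeral mult_ac)
  have c0: "0 < qpoch_inf q q ^ 5 * (1 - s^3)" using c s3 by simp
  have "qH s q m k = ?N / ?D" by (simp add: qH_def)
  moreover have "?N / ?D \<le> q ^ m / (qpoch_inf q q ^ 5 * (1 - s^3))"
    using N0 N D c0 q by (intro frac_le) auto
  moreover have "0 \<le> ?N / ?D"
    using N0 D c0 by (intro divide_nonneg_nonneg) linarith+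
  ultimately show ?thesis by (simp only: abs_of_nonneg)
qed

lemma qH_limit:
  assumes s: "0 < s" "s < 1" and q: "q = s^2"
  shows "(\<lambda>m. qH s q m 0) \<longlonglongrightarrow> qpoch_inf s q ^ 3 * qpoch_inf (s^5) q / qpoch_inf q q ^ 4"
proof -
  have q01: "0 < q" "q < 1" using s by (auto simp: q power_less_one_iff)
  have s3: "s^3 < 1" using s by (simp add: power_less_one_iff)
  have "qH s q m 0 = qpoch s q (Suc m) ^ 3 * qpoch (s^5) q m / (qpoch q q m * qpoch q q (Suc m) ^ 3)" for m
  proof -
    \<comment> \<open>The very-well-poised factor extends the product at s^3 by one term; splitting
      off its first factor instead moves the base to s^5 and cancels 1 - s^3.\<close>
    have "q * s^3 = s^5" by (simp add: q eval_nat_numeral)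
    then have *: "qpoch (s^3) q m * (1 - q ^ m * s^3) = (1 - s^3) * qpoch (s^5) q m"
      using qpoch_Suc[of "s^3" q m] qpoch_Suc_shift[of "s^3" q m] by simp
    have "qH s q m 0 = qpoch s q (Suc m) ^ 3 * (qpoch (s^3) q m * (1 - q ^ m * s^3))
        / (qpoch q q m * qpoch q q (Suc m) ^ 3 * (1 - s^3))"
      by (simp add: qH_def qpoch_def[of _ _ 0] mult_ac)
    then show ?thesis unfolding * using s3 by simp
  qed
  moreover have "(\<lambda>m. qpoch s q (Suc m) ^ 3 * qpoch (s^5) q m / (qpoch q q m * qpoch q q (Suc m) ^ 3))
      \<longlonglongrightarrow> qpoch_inf s q ^ 3 * qpoch_inf (s^5) q / (qpoch_inf q q * qpoch_inf q q ^ 3)"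
    using qpoch_inf_lower_bound(1)[OF q01 q01]
    by (intro tendsto_intros qpoch_LIMSEQ LIMSEQ_Suc q01) auto
  ultimately show ?thesis by (simp add: eval_nat_numeral mult_ac)
qed

section \<open>The accelerated q-series\<close>

definition qterm :: "real \<Rightarrow> real \<Rightarrow> nat \<Rightarrow> real" where
  "qterm s q n = q ^ (2 * n\<^sup>2)
         * (qpoch s q n ^ 3 * qpoch s q (2*n+1) ^ 3 * qpoch (s^3) q (3*n) * (1 - q^(4*n) * s^3)
            / (qpoch q q n * qpoch q q (2*n) * qpoch q q (3*n+1) ^ 3 * (1 - s^3)))
         * (q ^ n
            + (1 - q ^ n) * (1 - q ^ (3*n+1)) ^ 3 * (1 - q^(5*n) * s)
              / ((1 - q^(3*n) * s) * (1 - q^(2*n) * s) ^ 3 * (1 - q^(4*n) * s^3))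
            + q ^ (3*n+1)
              * ((1 - q^n * s) ^ 3 * (1 - q^(3*n) * s^3) * (1 - q^(5*n) * s^7)
                 / ((1 - q ^ (3*n+2)) ^ 3 * (1 - q ^ (2*n+1)) * (1 - q^(4*n) * s^3))))"

text \<open>The exponent (2n+1)n = 2n^2 + n in \<open>qH s q (2*n) n\<close> leaves q^n after the
  prefactor is taken out; the two values of \<open>qG\<close> divided by the same prefactor give the
  fractions in the braces. For n = 0 there is no preceding row, in agreement with the factor 1 -
  q^n.\<close>

lemma qterm_split:
  assumes s: "0 < s" "s < 1" and q: "q = s^2"
  shows "qterm s q n = (if n = 0 then 0 else qG s q (2*n-1) n) + qH s q (2*n) n + qG s q (2*n) (n+1)"
proof -
  have q01: "0 < q" "q < 1" using s by (auto simp: q power_less_one_iff)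
  have s3: "0 < s^3" "s^3 < 1" using s by (auto simp: power_less_one_iff)
  define a b c d e f t T where "a = qpoch s q n" and "b = qpoch s q (2*n+1)"
    and "c = qpoch (s^3) q (3*n)" and "d = qpoch q q n" and "e = qpoch q q (2*n)"
    and "f = qpoch q q (3*n+1)" and "t = 1 - s^3" and "T = 1 - q^(4*n) * s^3"
  note nums = a_def[symmetric] b_def[symmetric] c_def[symmetric] d_def[symmetric] e_def[symmetric]
    f_def[symmetric] t_def[symmetric] T_def[symmetric]
  define u v w r1 r2 where "u = 1 - q^(2*n+1)" and "v = 1 - q^(n+1)" and "w = 1 - q^(3*n+2)"
    and "r1 = 1 - q^(3*n) * s" and "r2 = 1 - q^(2*n) * s"
  note nums' = u_def[symmetric] v_def[symmetric] w_def[symmetric] r1_def[symmetric] r2_def[symmetric]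
  have nz: "d \<noteq> 0" "e \<noteq> 0" "f \<noteq> 0" "t \<noteq> 0" "T \<noteq> 0" "u \<noteq> 0" "v \<noteq> 0" "w \<noteq> 0" "r1 \<noteq> 0" "r2 \<noteq> 0"
  proof -
    have *: "1 - q ^ j * s \<noteq> 0" "1 - q ^ j * s^3 \<noteq> 0" "1 - q ^ Suc j \<noteq> 0" for j
      using qpoch_factor_bounds(1)[OF q01 s, of j] qpoch_factor_bounds(1)[OF q01 s3, of j]
        qpoch_factor_bounds(1)[OF q01 q01, of j]
      by (auto simp: mult.commute)
    show "u \<noteq> 0" "v \<noteq> 0" "w \<noteq> 0" "r1 \<noteq> 0" "r2 \<noteq> 0" "T \<noteq> 0"
      using *(1,2) *(3)[of "2*n"] *(3)[of n] *(3)[of "3*n+1"]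
      by (simp_all add: u_def v_def w_def r1_def r2_def T_def)
    show "d \<noteq> 0" "e \<noteq> 0" "f \<noteq> 0" "t \<noteq> 0"
      using qpoch_pos[OF q01 q01] s3 by (auto simp: d_def e_def f_def t_def less_imp_neq[symmetric])
  qed
  have H: "qH s q (2*n) n = q^(2*n\<^sup>2) * (a^3 * b^3 * c * T / (d * e * f^3 * t)) * q^n"
  proof -
    have "(2*n+1)*n = 2*n\<^sup>2 + n" "2*n + n = 3*n" "2*n + 2*n = 4*n"
      by (simp_all add: algebra_simps power2_eq_square)
    then show ?thesis unfolding qH_def by (simp only: nums power_add) (simp add: mult_ac)
  qed
  have G: "qG s q (2*n) (n+1) = q^(2*n\<^sup>2) * (a^3 * b^3 * c * T / (d * e * f^3 * t))
      * (q ^ (3*n+1) * ((1 - q^n * s) ^ 3 * (1 - q^(3*n) * s^3) * (1 - q^(5*n) * s^7) / (w^3 * u * T)))"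
  proof -
    \<comment> \<open>The exponent exceeds 2n^2 by 3n+1, which is the power of q in front of the
      third term.\<close>
    have ix: "(2*n+1)*(n+1) = 2*n\<^sup>2 + (3*n+1)" "2*n + (n+1) = Suc (3*n)" "Suc (3*n) + 1 = Suc (3*n+1)"
      "2*(2*n) + (n+1) = 5*n+1"
      by (simp_all add: algebra_simps power2_eq_square)
    have qps: "qpoch s q (n+1) = a * (1 - q^n * s)" "qpoch (s^3) q (Suc (3*n)) = c * (1 - q^(3*n) * s^3)"
      "qpoch q q (n+1) = d * v" "qpoch q q (2*n+1) = e * u" "qpoch q q (Suc (3*n+1)) = f * w"
      "q^(5*n+1) * s^5 = q^(5*n) * s^7"
      by (simp_all add: a_def c_def d_def e_def f_def u_def v_def w_def qpoch_Suc mult_ac)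
         (simp add: q eval_nat_numeral)
    show ?thesis
      unfolding qG_def ix qps power_add[of q "2*n\<^sup>2"] nums nums' using nz
      by (simp add: power_mult_distrib mult_ac)
  qed
  have G': "(if n = 0 then 0 else qG s q (2*n-1) n) = q^(2*n\<^sup>2) * (a^3 * b^3 * c * T / (d * e * f^3 * t))
      * ((1 - q ^ n) * (1 - q ^ (3*n+1)) ^ 3 * (1 - q^(5*n) * s) / (r1 * r2^3 * T))"
  proof (cases n)
    case 0
    then show ?thesis by simp
  next
    case (Suc j)
    \<comment> \<open>Writing n = j + 1 resolves the truncated subtraction in 2n - 1. The primed
      quantities are \<open>b\<close>, \<open>c\<close>, \<open>f\<close> without their last factors
      \<open>r2\<close>, \<open>r1\<close>, \<open>g\<close>, which therefore form the correction
      fraction.\<close>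
    define b' c' f' g where "b' = qpoch s q (2*n)" and "c' = qpoch (s^3) q (3*j+2)"
      and "f' = qpoch q q (3*n)" and "g = 1 - q^(3*n+1)"
    have ix: "2*n-1+1 = 2*n" "2*n*n = 2*n\<^sup>2" "2*n-1+n = 3*j+2" "3*j+2+1 = 3*n" "2*(2*n-1)+n = 5*j+3"
      using Suc by (simp_all add: power2_eq_square)
    have qps: "b = b' * r2" "c = c' * r1" "f = f' * g" "q^(5*j+3) * s^5 = q^(5*n) * s"
    proof -
      have e3: "3*n = Suc (3*j+2)" using Suc by simp
      have "q^(3*j+2) * s^3 = q^(3*n) * s" "q^(5*j+3) * s^5 = q^(5*n) * s"
        by (simp_all add: Suc q eval_nat_numeral)
      moreover have "qpoch (s^3) q (3*n) = c' * (1 - q^(3*j+2) * s^3)"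
        unfolding e3 c'_def by (rule qpoch_Suc)
      ultimately show "c = c' * r1" "q^(5*j+3) * s^5 = q^(5*n) * s"
        by (simp_all only: c_def r1_def)
      show "b = b' * r2" "f = f' * g"
        using qpoch_Suc[of s q "2*n"] qpoch_Suc[of q q "3*n"]
        by (simp_all add: b_def b'_def f_def f'_def r2_def g_def mult_ac)
    qed
    have nz': "f' \<noteq> 0" "g \<noteq> 0" using nz(3) qps by auto
    have "qG s q (2*n-1) n = a^3 * b'^3 * c' * q^(2*n\<^sup>2) * (1 - q^n) * (1 - q^(5*n) * s) / (d * e * f'^3 * t)"
      unfolding qG_def ix qps(4) nums by (simp add: b'_def c'_def f'_def)
    also have "\<dots> = q^(2*n\<^sup>2) * (a^3 * b^3 * c * T / (d * e * f^3 * t))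
      * ((1 - q ^ n) * g ^ 3 * (1 - q^(5*n) * s) / (r1 * r2^3 * T))"
      unfolding qps(1,2,3) using nz nz' by (simp add: power_mult_distrib mult_ac)
    finally show ?thesis using Suc by (simp add: g_def)
  qed
  have "K * (p + r + p') = K * r + K * p + K * p'" for K p r p' :: real
    by (simp add: distrib_left)
  then show ?thesis
    unfolding H G G' qterm_def nums nums' .
qed

lemma qterm_sums:
  assumes s: "0 < s" "s < 1" and q: "q = s^2"
  shows "qterm s q sums (qpoch_inf s q ^ 3 * qpoch_inf (s^5) q / qpoch_inf q q ^ 4)"
proof (rule wz_staircase_sums[where H = "qH s q" and G = "qG s q"])
  have q01: "0 < q" "q < 1" using s by (auto simp: q power_less_one_iff)
  have s3: "s^3 < 1" using s by (simp add: power_less_one_iff)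
  show "qH s q (Suc m) k - qH s q m k = qG s q m (Suc k) - qG s q m k" for m k
    by (rule q_wz[OF assms])
  show "qG s q m 0 = 0" for m by (simp add: qG_def)
  show "qterm s q 0 = qH s q 0 0 + qG s q 0 1" by (simp add: qterm_split[OF assms])
  show "qterm s q (Suc n) = qG s q (2*n+1) (n+1) + qH s q (2*n+2) (n+1) + qG s q (2*n+2) (n+2)" for n
    by (simp add: qterm_split[OF assms])
  show "(\<lambda>m. qH s q m 0) \<longlonglongrightarrow> qpoch_inf s q ^ 3 * qpoch_inf (s^5) q / qpoch_inf q q ^ 4"
    by (rule qH_limit[OF assms])
  show "\<bar>qH s q m k\<bar> \<le> q ^ m / (qpoch_inf q q ^ 5 * (1 - s^3))" if "1 \<le> k" for m k
    by (rule qH_bound[OF s q01 that])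
  have "(\<lambda>m. real m * q ^ m / (qpoch_inf q q ^ 5 * (1 - s^3))) \<longlonglongrightarrow> 0 / (qpoch_inf q q ^ 5 * (1 - s^3))"
    using qpoch_inf_lower_bound(1)[OF q01 q01] s3 q01
    by (intro tendsto_divide tendsto_const powser_times_n_limit_0) auto
  then show "(\<lambda>m. real m * (q ^ m / (qpoch_inf q q ^ 5 * (1 - s^3)))) \<longlonglongrightarrow> 0" by simp
qed

text \<open>The fractional exponents of the theorem have this shape, with i = 0 for the constant
  ones; it turns them into natural powers of q and of q^(1/2).\<close>

lemma powr_half_add:
  fixes q :: real
  assumes "0 < q"
  shows "q powr (real i * real n + real j / 2) = q ^ (i*n) * (q powr (1/2)) ^ j"
proof -
  have "q powr (real i * real n + real j / 2) = q powr real (i*n) * q powr (1/2 * real j)"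
    by (simp add: powr_add)
  then show ?thesis
    using assms by (simp only: powr_realpow powr_powr[symmetric]) (simp add: powr_realpow)
qed

section \<open>The classical Wilf-Zeilberger pair\<close>

definition cH :: "nat \<Rightarrow> nat \<Rightarrow> real" where
  "cH m k = 8 * pochhammer (1/2) k ^ 3 * pochhammer (1/2) (m+1) ^ 3 * pochhammer (3/2) (m+k)
     * (4 * real k + 2 * real m + 3) / (fact k * fact m * fact (m+k+1) ^ 3)"

text \<open>\<open>cH\<close> and \<open>cG\<close> are 24 times the formal limits of
  \<open>qH\<close> and \<open>qG\<close> for s = q^(1/2) and q tending to 1. The resulting constant
  8 later turns (1/2)_(2n+1)^3 into (3/2)_(2n)^3.\<close>

definition cG :: "nat \<Rightarrow> nat \<Rightarrow> real" where
  "cG m k = 8 * pochhammer (1/2) k ^ 3 * pochhammer (1/2) (m+1) ^ 3 * pochhammer (3/2) (m+k)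
     * real k * (4 * real m + 2 * real k + 5) / (fact k * fact (m+1) * fact (m+k+1) ^ 3)"

lemma c_wz: "cH (Suc m) k - cH m k = cG m (Suc k) - cG m k"
proof -
  define a b c d e f :: real where "a = pochhammer (1/2) k" and "b = pochhammer (1/2) (m+1)"
    and "c = pochhammer (3/2) (m+k)" and "d = fact k" and "e = fact m" and "f = fact (m+k+1)"
  define x y u v w where "x = real k" and "y = real m" and "u = y + 1" and "v = x + 1" and "w = x + y + 2"
  have nz: "d \<noteq> 0" "e \<noteq> 0" "f \<noteq> 0" "u \<noteq> 0" "v \<noteq> 0" "w \<noteq> 0"
    by (auto simp: d_def e_def f_def u_def v_def w_def x_def y_def add_eq_0_iff)
  have vals: "pochhammer (1/2) k = a" "pochhammer (1/2) (Suc k) = a * (x + 1/2)"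
    "pochhammer (1/2) (m+1) = b" "pochhammer (1/2) (Suc m+1) = b * (y + 3/2)"
    "pochhammer (3/2) (m+k) = c" "pochhammer (3/2) (Suc m+k) = c * (x + y + 3/2)"
    "pochhammer (3/2) (m+Suc k) = c * (x + y + 3/2)"
    "fact k = d" "fact (Suc k) = d * v" "fact m = e" "fact (Suc m) = e * u" "fact (m+1) = e * u"
    "fact (m+k+1) = f" "fact (Suc m+k+1) = f * w" "fact (m+Suc k+1) = f * w"
    "real k = x" "real m = y" "real (Suc k) = v" "real (Suc m) = u"
    by (simp_all add: a_def b_def c_def d_def e_def f_def u_def v_def w_def x_def y_def
        pochhammer_Suc algebra_simps)
  define B where "B = 8 * a^3 * b^3 * c / (d * (e * u) * (f * w)^3)"
  have H0: "cH m k = B * ((4*x + 2*y + 3) * u * w^3)"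
    unfolding cH_def vals B_def using nz by (simp add: power_mult_distrib)
  have H1: "cH (Suc m) k = B * ((y + 3/2)^3 * (x + y + 3/2) * (4*x + 2*u + 3))"
    unfolding cH_def vals B_def using nz by (simp add: power_mult_distrib)
  have G0: "cG m k = B * (x * (4*y + 2*x + 5) * w^3)"
    unfolding cG_def vals B_def using nz by (simp add: power_mult_distrib)
  have G1: "cG m (Suc k) = B * ((x + 1/2)^3 * (x + y + 3/2) * (4*y + 2 * v + 5))"
    unfolding cG_def vals B_def using nz by (simp add: power_mult_distrib mult_ac)
  \<comment> \<open>Once \<open>B\<close> is divided out, this is a polynomial identity in x = k and
    y = m, checked by expansion.\<close>
  have "(y + 3/2)^3 * (x + y + 3/2) * (4*x + 2*u + 3) - (4*x + 2*y + 3) * u * w^3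
      = (x + 1/2)^3 * (x + y + 3/2) * (4*y + 2 * v + 5) - x * (4*y + 2*x + 5) * w^3"
    unfolding u_def v_def w_def by (simp add: field_simps eval_nat_numeral)
  then show ?thesis
    unfolding H0 H1 G0 G1 by (simp only: right_diff_distrib[symmetric])
qed

lemma cH_nonneg: "0 \<le> cH m k"
  by (simp add: cH_def pochhammer_nonneg)

text \<open>There is no geometric decay here, so column k is compared with column 0 through the
  ratios \<open>R\<close> of consecutive values of \<open>P\<close>. The first ratio gains 1/(m+1)^2
  and the later ones are at most 1. As k <= m, the linear factor grows at most threefold.\<close>

lemma cH_bound:
  assumes "1 \<le> k" "k \<le> m"
  shows "\<bar>cH m k\<bar> \<le> 3 * cH m 0 / real (Suc m) ^ 2"
proof -
  define P :: "nat \<Rightarrow> real" where "P k = pochhammer (1/2) k ^ 3 * pochhammer (3/2) (m+k) / (fact k * fact (m+k+1) ^ 3)" for k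
  define R where "R k = (real k + 1/2)^3 * (real m + real k + 3/2) / ((real k + 1) * (real m + real k + 2)^3)"
    for k :: nat
  have P_Suc: "P (Suc k) = P k * R k" for k
  proof -
    have "fact (m + Suc k + 1) = (real m + real k + 2) * fact (m+k+1)"
      "fact (Suc k) = (real k + 1) * fact k"
      "pochhammer (3/2) (m + Suc k) = pochhammer (3/2) (m+k) * (real m + real k + 3/2)"
      "pochhammer (1/2) (Suc k) = pochhammer (1/2) k * (real k + 1/2)"
      by (simp_all add: pochhammer_Suc algebra_simps)
    then show ?thesis
      unfolding P_def R_def by (simp only: power_mult_distrib times_divide_times_eq mult_ac)
  qed
  have P0: "0 \<le> P k" for k by (simp add: P_def pochhammer_nonneg)
  have R: "R k \<le> ((real k + 1/2) / (real m + real k + 2))^2" for k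
  proof -
    have "R k = ((real k + 1/2) / (real m + real k + 2))^2
        * (((real k + 1/2) / (real k + 1)) * ((real m + real k + 3/2) / (real m + real k + 2)))"
      by (simp add: R_def power_divide eval_nat_numeral mult_ac)
    also have "\<dots> \<le> ((real k + 1/2) / (real m + real k + 2))^2 * (1 * 1)"
      by (intro mult_left_mono mult_mono) auto
    finally show ?thesis by simp
  qed
  have R1: "R k \<le> 1" for k
  proof -
    have "((real k + 1/2) / (real m + real k + 2))^2 \<le> 1"
      by (intro power_le_one) auto
    with R[of k] show ?thesis by linarith
  qed
  have "P (Suc j) \<le> P 0 / real (Suc m) ^ 2" for j
  proof (induction j)
    case 0
    \<comment> \<open>The ratio is at most ((1/2)/(m+2))^2; this is the only place where decay in m
      is gained.\<close>
    have "R 0 \<le> (1 / real (Suc m))^2"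
      by (rule order_trans[OF R], rule power_mono) (auto simp: divide_simps)
    then have "P 0 * R 0 \<le> P 0 * (1 / real (Suc m))^2"
      using P0 by (intro mult_left_mono)
    then show ?case by (simp add: P_Suc[of 0] power_divide)
  next
    case (Suc j)
    have "P (Suc (Suc j)) \<le> P (Suc j)"
      using P_Suc[of "Suc j"] R1[of "Suc j"] P0[of "Suc j"] by (simp add: mult_left_le)
    with Suc show ?case by linarith
  qed
  from this[of "k - 1"] have P: "P k \<le> P 0 / real (Suc m) ^ 2" using assms by simp
  define C where "C = 8 * pochhammer (1/2) (m+1) ^ 3 / (fact m :: real)"
  have C: "0 \<le> C" by (simp add: C_def pochhammer_nonneg)
  have cH: "cH m k = C * (P k * (4 * real k + 2 * real m + 3))" for k
    by (simp add: cH_def C_def P_def mult_ac)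
  have "P k * (4 * real k + 2 * real m + 3) \<le> (P 0 / real (Suc m) ^ 2) * (3 * (2 * real m + 3))"
    using assms P P0 by (intro mult_mono) auto
  from mult_left_mono[OF this C] show ?thesis
    using cH_nonneg[of m k] by (simp add: cH mult_ac)
qed

text \<open>From n to n + 1 the three factors change by (2n+1)^2/(2n+2)^2, (2n+3)/(2n+1) and
  (2n+2)^2/((2n+1)(2n+3)), whose product is 1. This links (1/2)_n / n! to the partial products of
  Wallis.\<close>

lemma pochhammer_half_wallis:
  "(pochhammer (1/2) n / fact n)\<^sup>2 * (2 * real n + 1) * (\<Prod>k=1..n. (4 * real k ^ 2) / (4 * real k ^ 2 - 1)) = 1"
proof (induction n)
  case 0
  show ?case by simp
next
  case (Suc n)
  define w x W where "w = pochhammer (1/2) n / (fact n :: real)" and "x = real n"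
    and "W = (\<Prod>k=1..n. (4 * real k ^ 2) / (4 * real k ^ 2 - 1))"
  have x: "x \<ge> 0" by (simp add: x_def)
  have e1: "pochhammer (1/2) (Suc n) / (fact (Suc n) :: real) = w * ((x + 1/2) / (x + 1))"
    by (simp add: w_def x_def pochhammer_Suc field_simps)
  have e2: "(\<Prod>k=1..Suc n. (4 * real k ^ 2) / (4 * real k ^ 2 - 1))
      = W * (4 * (x + 1)^2 / ((2*x + 1) * (2*x + 3)))"
    by (simp add: W_def x_def power2_eq_square algebra_simps)
  have e3: "(w * ((x + 1/2) / (x + 1)))^2 * (2 * (x + 1) + 1) * (W * (4 * (x + 1)^2 / ((2*x + 1) * (2*x + 3))))
      = w^2 * (2*x + 1) * W"
  proof -
    have "((x + 1/2) / (x + 1))^2 * (2 * (x + 1) + 1) * (4 * (x + 1)^2 / ((2*x + 1) * (2*x + 3))) = 2*x + 1"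
      using x by (simp add: divide_simps power2_eq_square) (simp add: algebra_simps)
    moreover have "(w * r)^2 * p * (W * z) = w^2 * (r^2 * p * z) * W" for r p z
      by (simp add: power_mult_distrib mult_ac)
    ultimately show ?thesis by (simp only:)
  qed
  have "real (Suc n) = x + 1" by (simp add: x_def)
  then show ?case
    unfolding e1 e2 by (simp only: e3) (simp only: w_def W_def x_def Suc.IH)
qed

lemma cH_limit: "(\<lambda>m. cH m 0) \<longlonglongrightarrow> 32 / pi\<^sup>2"
proof -
  define W where "W n = (\<Prod>k=1..n. (4 * real k ^ 2) / (4 * real k ^ 2 - 1))" for n
  have "cH m 0 = 16 / W (Suc m) ^ 2 * (1 / (2 + inverse (real (Suc m))))" for m
  proof -
    define w n where "w = pochhammer (1/2) (Suc m) / (fact (Suc m) :: real)" and "n = real (Suc m)"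
    have n: "n > 0" by (simp add: n_def)
    have eq: "w^2 * (2 * n + 1) * W (Suc m) = 1"
      using pochhammer_half_wallis[of "Suc m"] by (simp only: w_def W_def n_def)
    have "pochhammer (3/2) m = 2 * pochhammer (1/2) (Suc m) / (1::real)"
      by (simp add: pochhammer_rec)
    moreover have "pochhammer (1/2) (Suc m) = w * fact (Suc m)"
      by (simp add: w_def del: fact_Suc)
    moreover have "fact (Suc m) = n * (fact m :: real)" by (simp add: n_def)
    \<comment> \<open>With n = m + 1 everything is expressed by w = (1/2)_n / n!. Then w^4 is
      grouped as the square of w^2 (2n+1), the reciprocal Wallis product, leaving n/(2n+1), which
      tends to 1/2.\<close>
    ultimately have "cH m 0 = 16 * w^4 * n * (2 * n + 1)"
      using n by (simp add: cH_def power_mult_distrib del: fact_Suc) (simp add: n_def eval_nat_numeral field_simps)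
    also have "\<dots> = 16 * (w^2 * (2 * n + 1))^2 * (n / (2 * n + 1))"
      using n by (simp add: power_mult_distrib divide_simps eval_nat_numeral)
    also have "w^2 * (2 * n + 1) = 1 / W (Suc m)"
      using eq by (metis mult_zero_right nonzero_eq_divide_eq zero_neq_one)
    also have "n / (2 * n + 1) = 1 / (2 + inverse n)"
      using n by (simp add: field_simps)
    finally show ?thesis by (simp add: power_divide n_def)
  qed
  moreover have "(\<lambda>m. 16 / W (Suc m) ^ 2 * (1 / (2 + inverse (real (Suc m))))) \<longlonglongrightarrow> 16 / (pi/2)^2 * (1 / (2 + 0))"
    using wallis unfolding W_def
    by (intro tendsto_intros LIMSEQ_Suc[where f = "\<lambda>n. \<Prod>k=1..n. _ k"] LIMSEQ_inverse_real_of_nat) auto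
  ultimately show ?thesis by (simp add: power_divide)
qed

section \<open>The accelerated series for 32/pi^2\<close>

definition cterm :: "nat \<Rightarrow> real" where
  "cterm n = (3 + 8 * real n)
         * (pochhammer (1/2) n ^ 3 * pochhammer (3/2) (2*n) ^ 3 * pochhammer (3/2) (3*n)
            / (fact n * fact (2*n) * fact (3*n+1) ^ 3))
         * (1
            + 16 * real n * (1 + 3 * real n) ^ 3 * (1 + 10 * real n)
              / ((1 + 4 * real n) ^ 3 * (1 + 6 * real n) * (3 + 8 * real n))
            + 3 * (1 + 2 * real n) ^ 3 * (7 + 10 * real n)
              / (16 * (2 + 3 * real n) ^ 3 * (3 + 8 * real n)))"

lemma cterm_split:
  "cterm n = (if n = 0 then 0 else cG (2*n-1) n) + cH (2*n) n + cG (2*n) (n+1)"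
proof -
  define a b c d e f x :: real where "a = pochhammer (1/2) n" and "b = pochhammer (1/2) (2*n+1)"
    and "c = pochhammer (3/2) (3*n)" and "d = fact n" and "e = fact (2*n)" and "f = fact (3*n+1)"
    and "x = real n"
  have x: "x \<ge> 0" by (simp add: x_def)
  have nz: "d \<noteq> 0" "e \<noteq> 0" "f \<noteq> 0" by (auto simp: d_def e_def f_def)
  have b: "pochhammer (3/2) (2*n) = 2 * b" by (simp add: b_def pochhammer_rec)
  define K where "K = 8 * a^3 * b^3 * c / (d * e * f^3)"
  note nums = a_def[symmetric] b_def[symmetric] c_def[symmetric] d_def[symmetric] e_def[symmetric]
    f_def[symmetric] x_def[symmetric]
  have H: "cH (2*n) n = K * (3 + 8*x)"
  proof -
    have "2*n + n = 3*n" by simp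
    then show ?thesis unfolding cH_def K_def by (simp only: nums) (simp add: x_def)
  qed
  have G: "cG (2*n) (n+1) = K * (3 * (1 + 2*x)^3 * (7 + 10*x) / (16 * (2 + 3*x)^3))"
  proof -
    define u v w where "u = 2*x + 1" and "v = x + 1" and "w = 3*x + 2"
    have nz': "u \<noteq> 0" "v \<noteq> 0" "w \<noteq> 0" using x by (auto simp: u_def v_def w_def)
    have vals: "pochhammer (1/2) (n+1) = a * (u / 2)" "pochhammer (3/2) (2*n+(n+1)) = c * (3 * u / 2)"
      "fact (n+1) = d * v" "fact (2*n+1) = e * u" "fact (2*n+(n+1)+1) = f * w" "real (n+1) = v"
      "4 * real (2*n) + 2 * v + 5 = 7 + 10*x"
      by (simp_all add: a_def c_def d_def e_def f_def u_def v_def w_def x_def pochhammer_Suc algebra_simps)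
    have "cG (2*n) (n+1) = K * (3 * u^3 * (7 + 10*x) / (16 * w^3))"
      unfolding cG_def vals nums K_def using nz nz'
      by (simp add: power_mult_distrib power_divide field_simps)
    then show ?thesis by (simp add: u_def w_def add.commute)
  qed
  have G': "(if n = 0 then 0 else cG (2*n-1) n)
      = K * (16 * x * (1 + 3*x)^3 * (1 + 10*x) / ((1 + 4*x)^3 * (1 + 6*x)))"
  proof (cases n)
    case 0
    then show ?thesis by (simp add: x_def)
  next
    case (Suc j)
    \<comment> \<open>\<open>r2 / 2\<close>, \<open>r1 / 2\<close> and \<open>g\<close> are the last
      factors of \<open>b\<close>, \<open>c\<close> and \<open>f\<close>. The halves, cubed for
      \<open>b\<close> and single for \<open>c\<close>, produce the constant 16.\<close>
    define b' c' f' g r1 r2 :: real where "b' = pochhammer (1/2) (2*n)" and "c' = pochhammer (3/2) (3*j+2)"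
      and "f' = fact (3*n)" and "g = 3*x + 1" and "r1 = 6*x + 1" and "r2 = 4*x + 1"
    have e3: "3*n = Suc (3*j+2)" using Suc by simp
    have ix: "2*n-1+1 = 2*n" "2*n-1+n = 3*j+2" "3*j+2+1 = 3*n" "4 * real (2*n-1) + 2*real n + 5 = 1 + 10*x"
      using Suc by (simp_all add: x_def)
    have "c = c' * (3/2 + real (3*j+2))"
      unfolding c_def c'_def e3 by (rule pochhammer_Suc)
    moreover have "real (3*j+2) = 3*x - 1" using Suc by (simp add: x_def)
    ultimately have c: "c = c' * (r1 / 2)" by (simp add: r1_def)
    have bf: "b = b' * (r2 / 2)" "f = f' * g"
      by (simp_all add: b_def b'_def f_def f'_def r2_def g_def x_def pochhammer_Suc algebra_simps)
    have nz': "f' \<noteq> 0" "g \<noteq> 0" "r1 \<noteq> 0" "r2 \<noteq> 0" using x by (auto simp: f'_def g_def r1_def r2_def)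
    have "cG (2*n-1) n = 8 * a^3 * b'^3 * c' * x * (1 + 10*x) / (d * e * f'^3)"
      unfolding cG_def ix unfolding nums by (simp add: b'_def c'_def f'_def)
    also have "\<dots> = K * (16 * x * g^3 * (1 + 10*x) / (r2^3 * r1))"
      unfolding K_def c bf using nz nz' by (simp add: power_mult_distrib power_divide field_simps)
    finally show ?thesis using Suc by (simp add: g_def r1_def r2_def add.commute)
  qed
  have "T * K * (1 + A / (D * T) + A' / (D' * T)) = K * (A / D) + K * T + K * (A' / D')"
    if "T \<noteq> 0" for T A D A' D'
    using that by (simp add: distrib_left)
  moreover have "3 + 8*x \<noteq> 0" using x by simp
  moreover have "cterm n = (3 + 8*x) * K
      * (1 + 16 * x * (1 + 3*x)^3 * (1 + 10*x) / ((1 + 4*x)^3 * (1 + 6*x) * (3 + 8*x))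
         + 3 * (1 + 2*x)^3 * (7 + 10*x) / (16 * (2 + 3*x)^3 * (3 + 8*x)))"
    unfolding cterm_def b nums K_def by (simp add: power_mult_distrib)
  ultimately show ?thesis unfolding H G G' by simp
qed

lemma cterm_sums: "cterm sums (32 / pi\<^sup>2)"
proof (rule wz_staircase_sums[where H = cH and G = cG])
  show "cH (Suc m) k - cH m k = cG m (Suc k) - cG m k" for m k by (rule c_wz)
  show "cG m 0 = 0" for m by (simp add: cG_def)
  show "cterm 0 = cH 0 0 + cG 0 1" by (simp add: cterm_split)
  show "cterm (Suc n) = cG (2*n+1) (n+1) + cH (2*n+2) (n+1) + cG (2*n+2) (n+2)" for n
    by (simp add: cterm_split)
  show "(\<lambda>m. cH m 0) \<longlonglongrightarrow> 32 / pi\<^sup>2" by (rule cH_limit)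
  show "\<bar>cH m k\<bar> \<le> 3 * cH m 0 / real (Suc m) ^ 2" if "1 \<le> k" "k \<le> m" for m k
    by (rule cH_bound[OF that])
  \<comment> \<open>Column 0 converges by \<open>cH_limit\<close>, so one of the two factors 1/(m+1)
    absorbs m and the other still forces the limit 0.\<close>
  have "(\<lambda>m. 3 * cH m 0 * (real m / real (Suc m)) * inverse (real (Suc m))) \<longlonglongrightarrow> 3 * (32 / pi\<^sup>2) * 1 * 0"
    by (intro tendsto_intros cH_limit LIMSEQ_n_over_Suc_n LIMSEQ_inverse_real_of_nat)
  then show "(\<lambda>m. real m * (3 * cH m 0 / real (Suc m) ^ 2)) \<longlonglongrightarrow> 0"
    by (simp add: power2_eq_square divide_inverse mult_ac)
qed

theorem mainTheorem14:
  shows "(\<forall>q::real. 0 < q \<and> q < 1 \<longrightarrow>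
      (\<lambda>n::nat.
         q ^ (2 * n\<^sup>2)
         * (qpoch (q powr (1/2)) q n ^ 3 * qpoch (q powr (1/2)) q (2*n+1) ^ 3
              * qpoch (q powr (3/2)) q (3*n) * (1 - q powr (4 * real n + 3/2))
            / (qpoch q q n * qpoch q q (2*n) * qpoch q q (3*n+1) ^ 3 * (1 - q powr (3/2))))
         * (q ^ n
            + (1 - q ^ n) * (1 - q ^ (3*n+1)) ^ 3 * (1 - q powr (5 * real n + 1/2))
              / ((1 - q powr (3 * real n + 1/2)) * (1 - q powr (2 * real n + 1/2)) ^ 3
                 * (1 - q powr (4 * real n + 3/2)))
            + q ^ (3*n+1)
              * ((1 - q powr (real n + 1/2)) ^ 3 * (1 - q powr (3 * real n + 3/2))
                   * (1 - q powr (5 * real n + 7/2))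
                 / ((1 - q ^ (3*n+2)) ^ 3 * (1 - q ^ (2*n+1)) * (1 - q powr (4 * real n + 3/2))))))
      sums (qpoch_inf (q powr (1/2)) q ^ 3 * qpoch_inf (q powr (5/2)) q / qpoch_inf q q ^ 4))
    \<and>
      (\<lambda>n::nat.
         (3 + 8 * real n)
         * (pochhammer (1/2) n ^ 3 * pochhammer (3/2) (2*n) ^ 3 * pochhammer (3/2) (3*n)
            / (fact n * fact (2*n) * fact (3*n+1) ^ 3))
         * (1
            + 16 * real n * (1 + 3 * real n) ^ 3 * (1 + 10 * real n)
              / ((1 + 4 * real n) ^ 3 * (1 + 6 * real n) * (3 + 8 * real n))
            + 3 * (1 + 2 * real n) ^ 3 * (7 + 10 * real n)
              / (16 * (2 + 3 * real n) ^ 3 * (3 + 8 * real n))))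
      sums (32 / pi\<^sup>2)"
proof (intro conjI allI impI, elim conjE)
  fix q :: real
  assume q: "0 < q" "q < 1"
  \<comment> \<open>With s the square root of q, the first series becomes \<open>qterm s q\<close>,
    which contains only natural powers.\<close>
  define s where "s = q powr (1/2)"
  have s: "0 < s" "s < 1" "q = s^2"
    using q by (auto simp: s_def powr_half_sqrt)
  have powrs: "q powr (1/2) = s" "q powr (3/2) = s^3" "q powr (5/2) = s^5"
    "q powr (4 * real n + 3/2) = q^(4*n) * s^3" "q powr (5 * real n + 1/2) = q^(5*n) * s"
    "q powr (3 * real n + 1/2) = q^(3*n) * s" "q powr (2 * real n + 1/2) = q^(2*n) * s"
    "q powr (real n + 1/2) = q^n * s" "q powr (3 * real n + 3/2) = q^(3*n) * s^3"
    "q powr (5 * real n + 7/2) = q^(5*n) * s^7" for n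
    using powr_half_add[OF q(1), of 0 n 3] powr_half_add[OF q(1), of 0 n 5]
      powr_half_add[OF q(1), of 4 n 3] powr_half_add[OF q(1), of 5 n 1]
      powr_half_add[OF q(1), of 3 n 1] powr_half_add[OF q(1), of 2 n 1]
      powr_half_add[OF q(1), of 1 n 1] powr_half_add[OF q(1), of 3 n 3]
      powr_half_add[OF q(1), of 5 n 7]
    by (simp_all add: s_def)
  from qterm_sums[OF s] show "(\<lambda>n::nat.
         q ^ (2 * n\<^sup>2)
         * (qpoch (q powr (1/2)) q n ^ 3 * qpoch (q powr (1/2)) q (2*n+1) ^ 3
              * qpoch (q powr (3/2)) q (3*n) * (1 - q powr (4 * real n + 3/2))
            / (qpoch q q n * qpoch q q (2*n) * qpoch q q (3*n+1) ^ 3 * (1 - q powr (3/2))))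
         * (q ^ n
            + (1 - q ^ n) * (1 - q ^ (3*n+1)) ^ 3 * (1 - q powr (5 * real n + 1/2))
              / ((1 - q powr (3 * real n + 1/2)) * (1 - q powr (2 * real n + 1/2)) ^ 3
                 * (1 - q powr (4 * real n + 3/2)))
            + q ^ (3*n+1)
              * ((1 - q powr (real n + 1/2)) ^ 3 * (1 - q powr (3 * real n + 3/2))
                   * (1 - q powr (5 * real n + 7/2))
                 / ((1 - q ^ (3*n+2)) ^ 3 * (1 - q ^ (2*n+1)) * (1 - q powr (4 * real n + 3/2))))))
      sums (qpoch_inf (q powr (1/2)) q ^ 3 * qpoch_inf (q powr (5/2)) q / qpoch_inf q q ^ 4)"
    unfolding qterm_def[abs_def] powrs .
qed (rule cterm_sums[unfolded cterm_def[abs_def]])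

end
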